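(* Let $1<p,q<\infty$, $t_0>0$, $\lambda>0$, let $n\ge1$ be an integer, and let $u(t)$ be a solution, $u\not\equiv 0$, of $$\big(\operatorname{sgn}(u'')|u''|^{p-1}\big)''=\lambda\, \operatorname{sgn}(u)|u|^{q-1}\quad (0\le t\le t_0),\qquad u(0)=u(t_0)=u''(0)=u''(t_0)=0,$$ with exactly $n-1$ zeros in $(0,t_0)$. Then these zeros are all simple and located at $$t_j=\frac{j t_0}{n},\qquad j=1,\dots,n-1.$$ Moreover, in $(0,t_0)$, $u''(t)$ also vanishes exactly at the points $t_j$.
   Context: Solutions are understood in the sense that $u$, $u'$, $\operatorname{sgn}(u'')|u''|^{p-1}$ and $(\operatorname{sgn}(u'')|u''|^{p-1})'$ are of class $C^1$ on $[0,t_0]$ and the equation and boundary conditions hold. A zero $t_j$ of $u$ is simple if $u'(t_j)\neq0$. *)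

theory Defs
  imports "HOL-Analysis.Analysis"
begin

definition signed_powr :: "real \<Rightarrow> real \<Rightarrow> real" where
  "signed_powr r x = sgn x * \<bar>x\<bar> powr r"

(* Derivative relative to [0, T]: one-sided at the endpoints, and dependent only on
   the values of f on [0, T]. *)
definition ivl_deriv :: "real \<Rightarrow> (real \<Rightarrow> real) \<Rightarrow> real \<Rightarrow> real" where
  "ivl_deriv T f t = vector_derivative f (at t within {0..T})"

(* The library's C1_differentiable_on demands two-sided derivatives also at the endpoints
   of the interval, so it would constrain f outside [0, T]. *)
definition C1_ivl :: "real \<Rightarrow> (real \<Rightarrow> real) \<Rightarrow> bool" where
  "C1_ivl T f \<longleftrightarrow> f differentiable_on {0..T} \<and> continuous_on {0..T} (ivl_deriv T f)"

definition is_solution :: "real \<Rightarrow> real \<Rightarrow> real \<Rightarrow> real \<Rightarrow> (real \<Rightarrow> real) \<Rightarrow> bool" where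
  "is_solution p q lam T u \<longleftrightarrow>
     (let u1 = ivl_deriv T u; u2 = ivl_deriv T u1;
          w = (\<lambda>t. signed_powr (p - 1) (u2 t)); w1 = ivl_deriv T w
      in C1_ivl T u \<and> C1_ivl T u1 \<and> C1_ivl T w \<and> C1_ivl T w1 \<and>
         (\<forall>t\<in>{0..T}. ivl_deriv T w1 t = lam * signed_powr (q - 1) (u t)) \<and>
         u 0 = 0 \<and> u T = 0 \<and> u2 0 = 0 \<and> u2 T = 0)"

definition simple_zero :: "real \<Rightarrow> (real \<Rightarrow> real) \<Rightarrow> real \<Rightarrow> bool" where
  "simple_zero T u z \<longleftrightarrow> u z = 0 \<and> ivl_deriv T u z \<noteq> 0"

end

theory Submission
  imports Defs
begin

text \<open>
  With w = signed_powr (p - 1) u'' and a = 1 / (p - 1), the equation is the system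
  u'' = signed_powr a w, w'' = lam * signed_powr (q - 1) u, whose right-hand sides are increasing.
  Because u and w vanish at both ends, odd reflection extends the solution to a bounded periodic
  solution on the whole line. If u vanishes at c, compare the solution with its odd reflection
  about c: the sum y(t) = u(t) + u(2c - t) has y(c) = y'(c) = 0, and y'' has the sign of
  z(t) = w(t) + w(2c - t) while z'' has the sign of y. Were w(c) nonzero, y would be unbounded;
  hence w(c) = 0. The initial data of the two solutions at c then agree. As the zeros are isolated,
  the same growth argument shows that u and w have nonzero derivatives at common zeros, which yields
  uniqueness although the nonlinearities need not be Lipschitz at 0. So u is odd about each of its
  zeros, and the zeros form an arithmetic progression.
\<close>

section \<open>Monotonicity from the sign of the derivative; signed powers\<close>

lemma deriv_nonneg_imp_le:
  fixes f :: "real \<Rightarrow> real"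
  assumes "\<And>t. (f has_real_derivative f' t) (at t)"
    and "a \<le> b" and "\<And>t. a < t \<Longrightarrow> t < b \<Longrightarrow> 0 \<le> f' t"
  shows "f a \<le> f b"
proof (rule DERIV_nonneg_imp_increasing_open[OF \<open>a \<le> b\<close>])
  show "continuous_on {a..b} f"
    by (meson assms(1) DERIV_isCont continuous_at_imp_continuous_on)
qed (use assms in blast)

lemma deriv_pos_imp_less:
  fixes f :: "real \<Rightarrow> real"
  assumes "\<And>t. (f has_real_derivative f' t) (at t)"
    and "a < b" and "\<And>t. a < t \<Longrightarrow> t < b \<Longrightarrow> 0 < f' t"
  shows "f a < f b"
proof (rule DERIV_pos_imp_increasing_open[OF \<open>a < b\<close>])
  show "continuous_on {a..b} f"
    by (meson assms(1) DERIV_isCont continuous_at_imp_continuous_on)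
qed (use assms in blast)

lemma signed_powr_0 [simp]: "signed_powr r 0 = 0"
  by (simp add: signed_powr_def)

lemma signed_powr_minus [simp]: "signed_powr r (- x) = - signed_powr r x"
  by (simp add: signed_powr_def sgn_minus)

lemma signed_powr_nonneg: "0 \<le> x \<Longrightarrow> signed_powr r x = x powr r"
  by (cases "x = 0") (simp_all add: signed_powr_def)

lemma signed_powr_less:
  assumes "0 < r" "x < y"
  shows "signed_powr r x < signed_powr r y"
proof -
  consider "0 \<le> x" | "x < 0" "0 < y" | "y \<le> 0" using \<open>x < y\<close> by linarith
  then show ?thesis
  proof cases
    case 1
    then show ?thesis using assms by (simp add: signed_powr_nonneg powr_less_mono2)
  next
    case 2
    then have "0 < (- x) powr r + y powr r" by (simp add: add_pos_pos)
    with 2 show ?thesis by (simp add: signed_powr_def)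
  next
    case 3
    then have "signed_powr r (- y) < signed_powr r (- x)"
      using assms by (subst (1 2) signed_powr_nonneg) (simp_all add: powr_less_mono2)
    then show ?thesis by simp
  qed
qed

lemma signed_powr_less_iff: "0 < r \<Longrightarrow> signed_powr r x < signed_powr r y \<longleftrightarrow> x < y"
  by (metis linorder_less_linear order_less_asym signed_powr_less)

lemma signed_powr_eq_0_iff: "signed_powr r x = 0 \<longleftrightarrow> x = 0"
  by (simp add: signed_powr_def sgn_zero_iff)

lemma signed_powr_scale: "0 < k \<Longrightarrow> signed_powr r (k * x) = k powr r * signed_powr r x"
  by (simp add: signed_powr_def sgn_mult abs_mult powr_mult)

lemma signed_powr_inverse: "0 < r \<Longrightarrow> signed_powr (1 / r) (signed_powr r x) = x"
  by (simp add: signed_powr_def sgn_mult abs_mult powr_powr sgn_if)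

text \<open>Away from 0 a power has a bounded derivative, even for \<open>r < 1\<close>. The mean
  value bound is applied between \<open>x0 / 2\<close> and \<open>2 * x0\<close>, a range containing
  all admissible \<open>x\<close> and \<open>y\<close>.\<close>

lemma signed_powr_lipschitz_near_pos:
  assumes "0 < x0"
  shows "\<exists>L\<ge>0. \<forall>x y. \<bar>x - x0\<bar> < x0 / 2 \<longrightarrow> \<bar>y - x0\<bar> < x0 / 2 \<longrightarrow>
    \<bar>signed_powr r x - signed_powr r y\<bar> \<le> L * \<bar>x - y\<bar>"
proof -
  \<comment> \<open>The factor \<open>t powr (r - 1)\<close> is largest at the right end if
    \<open>1 \<le> r\<close> and at the left end otherwise; the sum covers both cases.\<close>
  define L where "L = \<bar>r\<bar> * ((x0 / 2) powr (r - 1) + (2 * x0) powr (r - 1))"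
  have "\<bar>signed_powr r x - signed_powr r y\<bar> \<le> L * \<bar>x - y\<bar>"
    if x: "\<bar>x - x0\<bar> < x0 / 2" and y: "\<bar>y - x0\<bar> < x0 / 2" for x y
  proof -
    have bound: "norm (r * t powr (r - 1)) \<le> L" if "t \<in> {x0 / 2..2 * x0}" for t
    proof -
      have "t powr (r - 1) \<le> (x0 / 2) powr (r - 1) + (2 * x0) powr (r - 1)"
      proof (cases "1 \<le> r")
        case True
        then have "t powr (r - 1) \<le> (2 * x0) powr (r - 1)"
          using that assms by (intro powr_mono2) auto
        then show ?thesis by (smt (verit) powr_ge_zero)
      next
        case False
        then have "t powr (r - 1) \<le> (x0 / 2) powr (r - 1)"
          using that assms by (intro powr_mono2') auto
        then show ?thesis by (smt (verit) powr_ge_zero)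
      qed
      then show ?thesis
        unfolding L_def by (simp add: abs_mult mult_left_mono)
    qed
    have "norm (x powr r - y powr r) \<le> L * norm (x - y)"
    proof (rule field_differentiable_bound[where S = "{x0 / 2..2 * x0}" and f' = "\<lambda>t. r * t powr (r - 1)"])
      fix t assume "t \<in> {x0 / 2..2 * x0}"
      then show "((\<lambda>t. t powr r) has_real_derivative r * t powr (r - 1)) (at t within {x0 / 2..2 * x0})"
        using assms by (auto intro!: has_real_derivative_powr DERIV_subset[OF has_real_derivative_powr])
    qed (use x y bound in \<open>auto simp: abs_if split: if_splits\<close>)
    moreover have "signed_powr r x = x powr r" "signed_powr r y = y powr r"
      using x y by (intro signed_powr_nonneg; linarith)+
    ultimately show ?thesis by simp
  qed
  moreover have "0 \<le> L" unfolding L_def by simp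
  ultimately show ?thesis by blast
qed

text \<open>For negative \<open>x0\<close>, oddness of the signed power transfers the bound from
  \<open>- x0\<close>.\<close>

lemma signed_powr_lipschitz_near:
  assumes "x0 \<noteq> 0"
  shows "\<exists>L\<ge>0. \<forall>x y. \<bar>x - x0\<bar> < \<bar>x0\<bar> / 2 \<longrightarrow> \<bar>y - x0\<bar> < \<bar>x0\<bar> / 2 \<longrightarrow>
    \<bar>signed_powr r x - signed_powr r y\<bar> \<le> L * \<bar>x - y\<bar>"
proof (cases "0 < x0")
  case True
  then show ?thesis using signed_powr_lipschitz_near_pos[of x0 r] by simp
next
  case False
  then obtain L where L: "0 \<le> L"
    "\<And>x y. \<bar>x - - x0\<bar> < - x0 / 2 \<Longrightarrow> \<bar>y - - x0\<bar> < - x0 / 2 \<Longrightarrow>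
    \<bar>signed_powr r x - signed_powr r y\<bar> \<le> L * \<bar>x - y\<bar>"
    using signed_powr_lipschitz_near_pos[of "- x0" r] assms by auto
  have "\<bar>signed_powr r x - signed_powr r y\<bar> \<le> L * \<bar>x - y\<bar>"
    if "\<bar>x - x0\<bar> < \<bar>x0\<bar> / 2" "\<bar>y - x0\<bar> < \<bar>x0\<bar> / 2" for x y
  proof -
    have "\<bar>- x - - x0\<bar> < - x0 / 2" "\<bar>- y - - x0\<bar> < - x0 / 2"
      using that False by linarith+
    then have "\<bar>signed_powr r (- x) - signed_powr r (- y)\<bar> \<le> L * \<bar>- x - - y\<bar>"
      by (rule L(2))
    moreover have "\<bar>- x - - y\<bar> = \<bar>x - y\<bar>" by linarith
    ultimately show ?thesis by simp
  qed
  with L(1) show ?thesis by blast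
qed

section \<open>Unbounded growth in cooperative systems\<close>

text \<open>While \<open>z\<close> is positive, \<open>y\<close> is convex; while \<open>y\<close>
  is nonnegative, \<open>z\<close> is convex. With these initial data each keeps the other going, so
  \<open>y1\<close> ends up above a positive constant and \<open>y\<close> grows at least
  linearly.\<close>

lemma cooperative_unbounded:
  fixes y y1 z z1 P Q :: "real \<Rightarrow> real"
  assumes dy: "\<And>t. (y has_real_derivative y1 t) (at t)"
    and dy1: "\<And>t. (y1 has_real_derivative P t) (at t)"
    and dz: "\<And>t. (z has_real_derivative z1 t) (at t)"
    and dz1: "\<And>t. (z1 has_real_derivative Q t) (at t)"
    and P: "\<And>t. 0 < z t \<Longrightarrow> 0 < P t"
    and Q: "\<And>t. 0 \<le> y t \<Longrightarrow> 0 \<le> Q t"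
    and init: "0 \<le> y c" "0 \<le> y1 c" "0 < z c" "0 \<le> z1 c"
  shows "\<exists>t. M < y t"
proof -
  \<comment> \<open>One round of the feedback: \<open>z > 0\<close> before \<open>s\<close> gives in
    turn \<open>y1 \<ge> 0\<close>, \<open>y \<ge> 0\<close>, \<open>z1 \<ge> 0\<close> and
    \<open>z \<ge> z c\<close>, all of them up to and including \<open>s\<close>.\<close>
  have chain: "0 \<le> y1 t \<and> z c \<le> z t"
    if s: "\<And>t. c \<le> t \<Longrightarrow> t < s \<Longrightarrow> 0 < z t" and t: "c \<le> t" "t \<le> s" for s t
  proof -
    have y1: "0 \<le> y1 t" if "c \<le> t" "t \<le> s" for t
    proof -
      have "y1 c \<le> y1 t"
        by (rule deriv_nonneg_imp_le[OF dy1]) (use P s that in \<open>auto intro: less_imp_le\<close>)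
      with init show ?thesis by linarith
    qed
    have y: "0 \<le> y t" if "c \<le> t" "t \<le> s" for t
    proof -
      have "y c \<le> y t" by (rule deriv_nonneg_imp_le[OF dy]) (use y1 that in auto)
      with init show ?thesis by linarith
    qed
    have z1: "0 \<le> z1 t" if "c \<le> t" "t \<le> s" for t
    proof -
      have "z1 c \<le> z1 t" by (rule deriv_nonneg_imp_le[OF dz1]) (use y Q that in auto)
      with init show ?thesis by linarith
    qed
    have "z c \<le> z t" by (rule deriv_nonneg_imp_le[OF dz]) (use z1 t in auto)
    with y1 t show ?thesis by blast
  qed
  have contz: "continuous_on A z" for A
    by (meson dz DERIV_isCont continuous_at_imp_continuous_on)
  have zpos: "0 < z t" if "c \<le> t" for t
  proof (rule ccontr)
    assume neg: "\<not> 0 < z t"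
    \<comment> \<open>The least element of \<open>A\<close> would be the first time at which
      \<open>z\<close> fails to be positive; \<open>chain\<close> up to that time still gives
      \<open>z \<ge> z c > 0\<close> there.\<close>
    define A where "A = {s \<in> {c..t}. z s \<le> 0}"
    have "compact A"
    proof -
      have "A = {c..t} \<inter> z -` {..0}" by (auto simp: A_def)
      then have "closed A"
        using continuous_closed_preimage[OF contz, of "{c..t}" "{..0}"] by simp
      moreover have "bounded A" unfolding A_def by (rule bounded_subset[of "{c..t}"]) auto
      ultimately show ?thesis by (simp add: compact_eq_bounded_closed)
    qed
    moreover have "A \<noteq> {}" using neg that by (auto simp: A_def)
    ultimately have "\<exists>s\<in>A. \<forall>r\<in>A. s \<le> r" by (rule compact_attains_inf)
    then obtain s where s: "s \<in> A" "\<And>r. r \<in> A \<Longrightarrow> s \<le> r" by auto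
    have "0 < z r" if "c \<le> r" "r < s" for r
      using s(2)[of r] s(1) that by (force simp: A_def)
    then have "z c \<le> z s"
      using chain[of s s] s(1) by (simp add: A_def)
    with s init show False by (auto simp: A_def)
  qed
  \<comment> \<open>Since \<open>y1 c\<close> may be 0, the slope is taken one unit later, when it
    is strictly positive.\<close>
  define m where "m = y1 (c + 1)"
  have "y1 c < m"
    unfolding m_def by (rule deriv_pos_imp_less[OF dy1]) (use P zpos in auto)
  then have m: "0 < m" using init by linarith
  have y1m: "m \<le> y1 t" if "c + 1 \<le> t" for t
    unfolding m_def by (rule deriv_nonneg_imp_le[OF dy1]) (use P zpos that in \<open>auto intro: less_imp_le\<close>)
  define t where "t = c + 1 + (\<bar>M\<bar> + \<bar>y (c + 1)\<bar> + 1) / m"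
  have "y (c + 1) - m * (c + 1) \<le> y t - m * t"
  proof (rule deriv_nonneg_imp_le[where f = "\<lambda>t. y t - m * t" and f' = "\<lambda>t. y1 t - m"])
    show "((\<lambda>t. y t - m * t) has_real_derivative y1 t - m) (at t)" for t
      by (auto intro!: derivative_eq_intros dy)
    show "c + 1 \<le> t" using m by (simp add: t_def)
    show "0 \<le> y1 s - m" if "c + 1 < s" for s using y1m[of s] that by simp
  qed
  moreover have "m * t = m * (c + 1) + \<bar>M\<bar> + \<bar>y (c + 1)\<bar> + 1"
  proof -
    have "m * (t - (c + 1)) = \<bar>M\<bar> + \<bar>y (c + 1)\<bar> + 1" using m by (simp add: t_def)
    then show ?thesis by (simp add: right_diff_distrib)
  qed
  ultimately have "M < y t" by linarith
  then show ?thesis ..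
qed


section \<open>A Gronwall argument with a singular weight\<close>

text \<open>Mean value theorem. The bound on \<open>f'\<close> is required only strictly between
  \<open>d\<close> and \<open>t\<close>, so that it may come from an estimate that is singular at
  \<open>d\<close>.\<close>

lemma abs_le_of_deriv_bound:
  fixes f :: "real \<Rightarrow> real"
  assumes df: "\<And>t. (f has_real_derivative f' t) (at t)"
    and "f d = 0" "d \<le> t" and B: "\<And>s. d < s \<Longrightarrow> s < t \<Longrightarrow> \<bar>f' s\<bar> \<le> B"
  shows "\<bar>f t\<bar> \<le> B * (t - d)"
proof (cases "d = t")
  case True
  then show ?thesis using assms by simp
next
  case False
  then have "d < t" using \<open>d \<le> t\<close> by simp
  then obtain s where s: "d < s" "s < t" "f t - f d = (t - d) * f' s"
    using MVT2[of d t f f'] df by blast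
  then have "\<bar>f t\<bar> = \<bar>f' s\<bar> * (t - d)"
    using \<open>f d = 0\<close> \<open>d < t\<close> by (simp add: abs_mult)
  also have "\<dots> \<le> B * (t - d)"
    using B[OF s(1,2)] \<open>d < t\<close> by (simp add: mult_right_mono)
  finally show ?thesis .
qed

text \<open>
  The singular weight 1 / (t - d) is what remains of a signed power of exponent below 1 near a
  simple zero at d.
\<close>

lemma gronwall_singular:
  fixes y y1 z z1 P Q :: "real \<Rightarrow> real"
  assumes dy: "\<And>t. (y has_real_derivative y1 t) (at t)"
    and dy1: "\<And>t. (y1 has_real_derivative P t) (at t)"
    and dz: "\<And>t. (z has_real_derivative z1 t) (at t)"
    and dz1: "\<And>t. (z1 has_real_derivative Q t) (at t)"
    and init: "y d = 0" "y1 d = 0" "z d = 0" "z1 d = 0"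
    and C: "0 \<le> C" and \<delta>: "0 < \<delta>"
    and P: "\<And>t. d < t \<Longrightarrow> t < d + \<delta> \<Longrightarrow> \<bar>P t\<bar> \<le> C * (\<bar>z t\<bar> / (t - d))"
    and Q: "\<And>t. d < t \<Longrightarrow> t < d + \<delta> \<Longrightarrow> \<bar>Q t\<bar> \<le> C * (\<bar>y t\<bar> / (t - d))"
  shows "\<exists>e>0. \<forall>t\<in>{d..d + e}. y t = 0 \<and> y1 t = 0 \<and> z t = 0 \<and> z1 t = 0"
proof -
  \<comment> \<open>Small enough that the final estimate of \<open>N\<close> has a factor at most
    1/2 on the right.\<close>
  define e where "e = min (\<delta> / 2) (1 / (4 * (C + 1)))"
  have e: "0 < e" "e < \<delta>" "2 * (C * e) \<le> 1 / 2"
  proof -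
    show "0 < e" "e < \<delta>" using \<delta> C by (auto simp: e_def)
    have "e \<le> 1 / (4 * (C + 1))" by (simp add: e_def)
    then have "(C + 1) * e \<le> 1 / 4" using C by (simp add: field_simps)
    moreover have "C * e \<le> (C + 1) * e" using \<open>0 < e\<close> by simp
    ultimately show "2 * (C * e) \<le> 1 / 2" by linarith
  qed
  let ?I = "{d..d + e}"
  have "continuous_on ?I (\<lambda>t. \<bar>y1 t\<bar> + \<bar>z1 t\<bar>)"
    by (intro continuous_intros) (meson dy1 dz1 DERIV_isCont continuous_at_imp_continuous_on)+
  moreover have "?I \<noteq> {}" using e by simp
  ultimately obtain s where s: "s \<in> ?I" and sup: "\<And>t. t \<in> ?I \<Longrightarrow> \<bar>y1 t\<bar> + \<bar>z1 t\<bar> \<le> \<bar>y1 s\<bar> + \<bar>z1 s\<bar>"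
    using continuous_attains_sup[OF compact_Icc] by meson
  \<comment> \<open>The maximum of the first derivatives bounds \<open>y\<close> and
    \<open>z\<close> by \<open>N * (t - d)\<close>. This cancels the weight, so \<open>P\<close> and
    \<open>Q\<close> are at most \<open>C * N\<close>, and integrating up to the maximiser
    \<open>s\<close> bounds \<open>N\<close> by half of itself.\<close>
  define N where "N = \<bar>y1 s\<bar> + \<bar>z1 s\<bar>"
  have y: "\<bar>y t\<bar> \<le> N * (t - d)" and z: "\<bar>z t\<bar> \<le> N * (t - d)" if "t \<in> ?I" for t
  proof -
    have "\<bar>y1 r\<bar> \<le> N" "\<bar>z1 r\<bar> \<le> N" if "d < r" "r < t" for r
      using sup[of r] that \<open>t \<in> ?I\<close> unfolding N_def by auto
    then show "\<bar>y t\<bar> \<le> N * (t - d)" "\<bar>z t\<bar> \<le> N * (t - d)"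
      using that init by (auto intro!: abs_le_of_deriv_bound dy dz)
  qed
  have *: "C * (\<bar>x\<bar> / (t - d)) \<le> C * N" if "\<bar>x\<bar> \<le> N * (t - d)" "d < t" for x t
    using that C by (intro mult_left_mono) (simp_all add: divide_le_eq)
  have "\<bar>P t\<bar> \<le> C * N" "\<bar>Q t\<bar> \<le> C * N" if "d < t" "t < s" for t
    using P[of t] Q[of t] *[OF z[of t]] *[OF y[of t]] that s e by auto
  then have "\<bar>y1 s\<bar> \<le> C * N * (s - d)" "\<bar>z1 s\<bar> \<le> C * N * (s - d)"
    using init s by (auto intro!: abs_le_of_deriv_bound dy1 dz1)
  then have "N \<le> 2 * (C * N * (s - d))" by (simp add: N_def)
  also have "\<dots> \<le> 2 * (C * N * e)"
    using s C by (intro mult_left_mono mult_nonneg_nonneg) (auto simp: N_def)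
  also have "\<dots> = 2 * (C * e) * N" by simp
  also have "\<dots> \<le> 1 / 2 * N"
    by (intro mult_right_mono e) (simp add: N_def)
  finally have "N = 0" unfolding N_def by simp
  then have "y t = 0 \<and> y1 t = 0 \<and> z t = 0 \<and> z1 t = 0" if "t \<in> ?I" for t
    using y[OF that] z[OF that] sup[OF that] unfolding N_def[symmetric] \<open>N = 0\<close> by auto
  with e show ?thesis by blast
qed

text \<open>If \<open>u d\<close> is nonzero, the signed power is Lipschitz near it and the weight,
  being at least 1, only helps. If \<open>u d = 0\<close>, the quotients of \<open>u\<close> and
  \<open>v\<close> by \<open>t - d\<close> tend to \<open>m \<noteq> 0\<close>, and the Lipschitz
  bound near \<open>m\<close> applies to them.\<close>

lemma signed_powr_diff_bound:
  fixes u v :: "real \<Rightarrow> real"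
  assumes du: "(u has_real_derivative m) (at d)" and dv: "(v has_real_derivative m) (at d)"
    and "u d = v d" and nz: "u d \<noteq> 0 \<or> m \<noteq> 0" and "0 < r"
  shows "\<exists>C\<ge>0. \<forall>\<^sub>F t in at_right d.
    \<bar>signed_powr r (u t) - signed_powr r (v t)\<bar> \<le> C * (\<bar>u t - v t\<bar> / (t - d))"
proof -
  have near: "\<forall>\<^sub>F t in at_right d. d < t \<and> t < d + 1"
    by (auto simp: eventually_at_right_field intro: exI[of _ "d + 1"])
  show ?thesis
  proof (cases "u d = 0")
    case False
    obtain L where L: "0 \<le> L" and lip: "\<And>x y. \<bar>x - u d\<bar> < \<bar>u d\<bar> / 2 \<Longrightarrow> \<bar>y - u d\<bar> < \<bar>u d\<bar> / 2 \<Longrightarrow>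
        \<bar>signed_powr r x - signed_powr r y\<bar> \<le> L * \<bar>x - y\<bar>"
      using signed_powr_lipschitz_near[OF False] by blast
    have "(u \<longlongrightarrow> u d) (at_right d)" "(v \<longlongrightarrow> u d) (at_right d)"
      using DERIV_isCont[OF du] DERIV_isCont[OF dv] \<open>u d = v d\<close>
      by (auto simp: isCont_def filterlim_at_split)
    then have "\<forall>\<^sub>F t in at_right d. \<bar>u t - u d\<bar> < \<bar>u d\<bar> / 2" "\<forall>\<^sub>F t in at_right d. \<bar>v t - u d\<bar> < \<bar>u d\<bar> / 2"
      using False by (auto dest!: tendstoD[where e = "\<bar>u d\<bar> / 2"] simp: dist_real_def)
    with near have "\<forall>\<^sub>F t in at_right d.
      \<bar>signed_powr r (u t) - signed_powr r (v t)\<bar> \<le> L * (\<bar>u t - v t\<bar> / (t - d))"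
    proof eventually_elim
      case (elim t)
      have "\<bar>u t - v t\<bar> * (t - d) \<le> \<bar>u t - v t\<bar> * 1"
        using elim by (intro mult_left_mono) auto
      then have "\<bar>u t - v t\<bar> \<le> \<bar>u t - v t\<bar> / (t - d)"
        using elim by (simp add: le_divide_eq)
      then have "L * \<bar>u t - v t\<bar> \<le> L * (\<bar>u t - v t\<bar> / (t - d))"
        using L by (rule mult_left_mono)
      with lip[of "u t" "v t"] elim show ?case by linarith
    qed
    with L show ?thesis by blast
  next
    case True
    with nz have m: "m \<noteq> 0" by simp
    obtain L where L: "0 \<le> L" and lip: "\<And>x y. \<bar>x - m\<bar> < \<bar>m\<bar> / 2 \<Longrightarrow> \<bar>y - m\<bar> < \<bar>m\<bar> / 2 \<Longrightarrow>
        \<bar>signed_powr r x - signed_powr r y\<bar> \<le> L * \<bar>x - y\<bar>"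
      using signed_powr_lipschitz_near[OF m] by blast
    have "((\<lambda>t. u t / (t - d)) \<longlongrightarrow> m) (at_right d)" "((\<lambda>t. v t / (t - d)) \<longlongrightarrow> m) (at_right d)"
      using du dv True \<open>u d = v d\<close> by (auto simp: has_field_derivative_iff filterlim_at_split)
    then have "\<forall>\<^sub>F t in at_right d. \<bar>u t / (t - d) - m\<bar> < \<bar>m\<bar> / 2"
      "\<forall>\<^sub>F t in at_right d. \<bar>v t / (t - d) - m\<bar> < \<bar>m\<bar> / 2"
      using m by (auto dest!: tendstoD[where e = "\<bar>m\<bar> / 2"] simp: dist_real_def)
    with near have "\<forall>\<^sub>F t in at_right d.
      \<bar>signed_powr r (u t) - signed_powr r (v t)\<bar> \<le> L * (\<bar>u t - v t\<bar> / (t - d))"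
    proof eventually_elim
      case (elim t)
      \<comment> \<open>By homogeneity, dividing both arguments by \<open>h\<close> costs a factor
        \<open>h powr r\<close>, which is at most 1.\<close>
      define h where "h = t - d"
      have h: "0 < h" "h < 1" using elim by (auto simp: h_def)
      have "signed_powr r (x / h) = signed_powr r x / h powr r" for x
        using signed_powr_scale[of h r "x / h"] h by simp
      then have "\<bar>signed_powr r (u t) - signed_powr r (v t)\<bar>
        = h powr r * \<bar>signed_powr r (u t / h) - signed_powr r (v t / h)\<bar>"
        using h by (simp flip: diff_divide_distrib)
      also have "\<dots> \<le> 1 * \<bar>signed_powr r (u t / h) - signed_powr r (v t / h)\<bar>"
        using h \<open>0 < r\<close> by (intro mult_right_mono powr_le1) auto
      also have "\<dots> \<le> L * \<bar>u t / h - v t / h\<bar>"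
        using lip[of "u t / h" "v t / h"] elim by (simp add: h_def)
      also have "\<dots> = L * (\<bar>u t - v t\<bar> / h)"
        using h by (simp flip: diff_divide_distrib)
      finally show ?case by (simp add: h_def)
    qed
    with L show ?thesis by blast
  qed
qed

section \<open>The system of two signed powers, its symmetries and uniqueness\<close>

text \<open>The differential equation has \<open>k = 1\<close> and \<open>l = lam\<close>; two
  constants make the class closed under exchanging \<open>u\<close> and \<open>w\<close>, so results
  on zeros of \<open>u\<close> also serve for \<open>w\<close>.\<close>

definition power_system ::
  "real \<Rightarrow> real \<Rightarrow> real \<Rightarrow> real \<Rightarrow> (real \<Rightarrow> real) \<Rightarrow> (real \<Rightarrow> real) \<Rightarrow> (real \<Rightarrow> real) \<Rightarrow> (real \<Rightarrow> real) \<Rightarrow> bool"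
  where
  "power_system a b k l u u1 w w1 \<longleftrightarrow> 0 < a \<and> 0 < b \<and> 0 < k \<and> 0 < l \<and>
    (\<forall>t. (u has_real_derivative u1 t) (at t)) \<and>
    (\<forall>t. (u1 has_real_derivative k * signed_powr a (w t)) (at t)) \<and>
    (\<forall>t. (w has_real_derivative w1 t) (at t)) \<and>
    (\<forall>t. (w1 has_real_derivative l * signed_powr b (u t)) (at t))"

lemma power_systemD:
  assumes "power_system a b k l u u1 w w1"
  shows "0 < a" "0 < b" "0 < k" "0 < l"
    "\<And>t. (u has_real_derivative u1 t) (at t)"
    "\<And>t. (u1 has_real_derivative k * signed_powr a (w t)) (at t)"
    "\<And>t. (w has_real_derivative w1 t) (at t)"
    "\<And>t. (w1 has_real_derivative l * signed_powr b (u t)) (at t)"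
  using assms unfolding power_system_def by blast+

lemma power_system_swap:
  "power_system a b k l u u1 w w1 \<Longrightarrow> power_system b a l k w w1 u u1"
  unfolding power_system_def by blast

lemma power_system_uminus:
  assumes "power_system a b k l u u1 w w1"
  shows "power_system a b k l (\<lambda>t. - u t) (\<lambda>t. - u1 t) (\<lambda>t. - w t) (\<lambda>t. - w1 t)"
  using assms unfolding power_system_def by (auto intro!: derivative_eq_intros)

text \<open>Reflection leaves second derivatives unchanged in sign. The centre is
  \<open>c / 2\<close>: below, \<open>2 * c\<close> reflects about \<open>c\<close>, and 0 reverses
  time.\<close>

lemma power_system_reflect:
  assumes "power_system a b k l u u1 w w1"
  shows "power_system a b k l (\<lambda>t. u (c - t)) (\<lambda>t. - u1 (c - t)) (\<lambda>t. w (c - t)) (\<lambda>t. - w1 (c - t))"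
proof -
  have "((\<lambda>t. f (c - t)) has_real_derivative - f' (c - t)) (at t)"
    if "\<And>t. (f has_real_derivative f' t) (at t)" for f f' :: "real \<Rightarrow> real" and t
    by (rule DERIV_chain2[where f = f and g = "\<lambda>t. c - t", OF that, THEN DERIV_cong])
      (auto intro!: derivative_eq_intros)
  from this[OF power_systemD(5)[OF assms]] this[OF power_systemD(6)[OF assms], THEN DERIV_minus]
    this[OF power_systemD(7)[OF assms]] this[OF power_systemD(8)[OF assms], THEN DERIV_minus]
  show ?thesis
    using assms unfolding power_system_def by auto
qed

text \<open>The difference of the two solutions satisfies the hypotheses of
  \<open>gronwall_singular\<close>: wherever a component vanishes at \<open>d\<close>, its slope
  does not, so \<open>signed_powr_diff_bound\<close> controls both right-hand sides.\<close>

lemma power_system_unique_right: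
  assumes U: "power_system a b k l u u1 w w1" and V: "power_system a b k l v v1 x x1"
    and eq: "u d = v d" "u1 d = v1 d" "w d = x d" "w1 d = x1 d"
    and nz: "u d \<noteq> 0 \<or> u1 d \<noteq> 0" "w d \<noteq> 0 \<or> w1 d \<noteq> 0"
  shows "\<exists>e>0. \<forall>t\<in>{d..d + e}. u t = v t \<and> u1 t = v1 t \<and> w t = x t \<and> w1 t = x1 t"
proof -
  note dU = power_systemD[OF U] and dV = power_systemD[OF V]
  have dv: "(v has_real_derivative u1 d) (at d)" and dx: "(x has_real_derivative w1 d) (at d)"
    using dV(5)[of d] dV(7)[of d] eq by simp_all
  obtain C where C: "0 \<le> C" "\<forall>\<^sub>F t in at_right d.
      \<bar>signed_powr b (u t) - signed_powr b (v t)\<bar> \<le> C * (\<bar>u t - v t\<bar> / (t - d))"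
    using signed_powr_diff_bound[OF dU(5)[of d] dv eq(1) nz(1) dU(2)] by blast
  obtain D where D: "0 \<le> D" "\<forall>\<^sub>F t in at_right d.
      \<bar>signed_powr a (w t) - signed_powr a (x t)\<bar> \<le> D * (\<bar>w t - x t\<bar> / (t - d))"
    using signed_powr_diff_bound[OF dU(7)[of d] dx eq(3) nz(2) dU(1)] by blast
  from eventually_conj[OF C(2) D(2)]
  obtain c where c: "d < c"
    and C2: "\<And>t. d < t \<Longrightarrow> t < c \<Longrightarrow> \<bar>signed_powr b (u t) - signed_powr b (v t)\<bar> \<le> C * (\<bar>u t - v t\<bar> / (t - d))"
    and D2: "\<And>t. d < t \<Longrightarrow> t < c \<Longrightarrow> \<bar>signed_powr a (w t) - signed_powr a (x t)\<bar> \<le> D * (\<bar>w t - x t\<bar> / (t - d))"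
    by (auto simp: eventually_at_right_field)
  \<comment> \<open>Merges the separate constants for the two equations into the single one that
    \<open>gronwall_singular\<close> takes.\<close>
  have le: "\<bar>m * p - m * q\<bar> \<le> (k * D + l * C) * s"
    if "\<bar>p - q\<bar> \<le> E * s" "0 \<le> s" "0 < m" "m * E \<le> k * D + l * C" for m p q E s :: real
  proof -
    have "\<bar>m * p - m * q\<bar> = m * \<bar>p - q\<bar>"
      using that by (simp add: abs_mult flip: right_diff_distrib)
    also have "\<dots> \<le> m * (E * s)" using that by simp
    also have "\<dots> \<le> (k * D + l * C) * s"
      using that by (metis mult.assoc mult_right_mono)
    finally show ?thesis .
  qed
  have "\<exists>e>0. \<forall>t\<in>{d..d + e}. u t - v t = 0 \<and> u1 t - v1 t = 0 \<and> w t - x t = 0 \<and> w1 t - x1 t = 0"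
  proof (rule gronwall_singular[where C = "k * D + l * C" and \<delta> = "c - d" and
        P = "\<lambda>t. k * signed_powr a (w t) - k * signed_powr a (x t)" and
        Q = "\<lambda>t. l * signed_powr b (u t) - l * signed_powr b (v t)"])
    show "0 \<le> k * D + l * C" using C D dU by simp
    fix t assume t: "d < t" "t < d + (c - d)"
    show "\<bar>k * signed_powr a (w t) - k * signed_powr a (x t)\<bar> \<le> (k * D + l * C) * (\<bar>w t - x t\<bar> / (t - d))"
      by (rule le[OF D2]) (use t C D dU in auto)
    show "\<bar>l * signed_powr b (u t) - l * signed_powr b (v t)\<bar> \<le> (k * D + l * C) * (\<bar>u t - v t\<bar> / (t - d))"
      by (rule le[OF C2]) (use t C D dU in auto)
  qed (use c eq in \<open>simp_all add: DERIV_diff dU dV\<close>)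
  then show ?thesis by simp
qed

text \<open>The set where the solutions agree is closed by continuity and open by local uniqueness,
  and the line is connected.\<close>

lemma power_system_unique:
  assumes U: "power_system a b k l u u1 w w1" and V: "power_system a b k l v v1 x x1"
    and eq: "u c = v c" "u1 c = v1 c" "w c = x c" "w1 c = x1 c"
    and nz: "\<And>t. u t \<noteq> 0 \<or> u1 t \<noteq> 0" "\<And>t. w t \<noteq> 0 \<or> w1 t \<noteq> 0"
  shows "u t = v t"
proof -
  define K where "K = {t. u t = v t \<and> u1 t = v1 t \<and> w t = x t \<and> w1 t = x1 t}"
  have cont: "continuous_on UNIV f" if "\<And>t. (f has_real_derivative f' t) (at t)" for f f' :: "real \<Rightarrow> real"
    by (meson that DERIV_isCont continuous_at_imp_continuous_on)
  have "closed K"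
    unfolding K_def
    by (intro closed_Collect_conj closed_Collect_eq)
      (auto intro: cont power_systemD[OF U] power_systemD[OF V])
  moreover have "open K"
    unfolding open_contains_ball
  proof
    fix d assume "d \<in> K"
    then have d: "u d = v d" "u1 d = v1 d" "w d = x d" "w1 d = x1 d" by (auto simp: K_def)
    obtain e where e: "0 < e" "\<And>t. t \<in> {d..d + e} \<Longrightarrow> t \<in> K"
      using power_system_unique_right[OF U V d nz] unfolding K_def by auto
    \<comment> \<open>Agreement to the left of \<open>d\<close> is agreement to the right of
      \<open>- d\<close> after time reversal.\<close>
    have "\<exists>e'>0. \<forall>t\<in>{- d..- d + e'}. u (0 - t) = v (0 - t) \<and> - u1 (0 - t) = - v1 (0 - t) \<and>
        w (0 - t) = x (0 - t) \<and> - w1 (0 - t) = - x1 (0 - t)"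
      by (rule power_system_unique_right[OF power_system_reflect[OF U] power_system_reflect[OF V]])
        (use d nz[of d] in auto)
    then obtain e' where e': "0 < e'" "\<And>t. t \<in> {- d..- d + e'} \<Longrightarrow> 0 - t \<in> K"
      unfolding K_def by auto
    have "ball d (min e e') \<subseteq> K"
    proof
      fix t assume "t \<in> ball d (min e e')"
      then have t: "\<bar>d - t\<bar> < e" "\<bar>d - t\<bar> < e'" by (auto simp: dist_real_def)
      show "t \<in> K"
      proof (cases "d \<le> t")
        case True
        then show ?thesis using t by (intro e) auto
      next
        case False
        then show ?thesis using t e'(2)[of "- t"] by auto
      qed
    qed
    with e e' show "\<exists>e>0. ball d e \<subseteq> K" by (meson min_less_iff_conj)
  qed
  moreover have "c \<in> K" using eq by (simp add: K_def)
  ultimately have "K = UNIV" using clopen by blast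
  then show ?thesis by (auto simp: K_def)
qed


section \<open>Zeros of bounded solutions\<close>

text \<open>If \<open>w c > 0\<close>, the sum of the solution and its mirror image about
  \<open>c\<close> starts with \<open>y\<close>, \<open>y1\<close> and \<open>z1\<close> zero and
  \<open>z = 2 * w c\<close>, so \<open>y\<close> exceeds \<open>2 * M\<close> somewhere. Negating
  the solution excludes \<open>w c < 0\<close>.\<close>

lemma power_system_common_zero:
  assumes S: "power_system a b k l u u1 w w1" and B: "\<And>t. \<bar>u t\<bar> \<le> M" and "u c = 0"
  shows "w c = 0"
proof -
  have no: "\<not> 0 < w c"
    if S: "power_system a b k l u u1 w w1" and B: "\<And>t. \<bar>u t\<bar> \<le> M" and "u c = 0" for u u1 w w1
  proof
    assume "0 < w c"
    note dS = power_systemD[OF S] and dR = power_systemD[OF power_system_reflect[OF S, of "2 * c"]]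
    have "\<exists>t. 2 * M < u t + u (2 * c - t)"
    proof (rule cooperative_unbounded[where c = c and z = "\<lambda>t. w t + w (2 * c - t)" and
          P = "\<lambda>t. k * signed_powr a (w t) + k * signed_powr a (w (2 * c - t))" and
          Q = "\<lambda>t. l * signed_powr b (u t) + l * signed_powr b (u (2 * c - t))"])
      fix t
      show "((\<lambda>t. u t + u (2 * c - t)) has_real_derivative u1 t + - u1 (2 * c - t)) (at t)"
        "((\<lambda>t. u1 t + - u1 (2 * c - t)) has_real_derivative
          k * signed_powr a (w t) + k * signed_powr a (w (2 * c - t))) (at t)"
        "((\<lambda>t. w t + w (2 * c - t)) has_real_derivative w1 t + - w1 (2 * c - t)) (at t)"
        "((\<lambda>t. w1 t + - w1 (2 * c - t)) has_real_derivative
          l * signed_powr b (u t) + l * signed_powr b (u (2 * c - t))) (at t)"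
        by (intro DERIV_add dS dR)+
      show "0 < k * signed_powr a (w t) + k * signed_powr a (w (2 * c - t))"
        if "0 < w t + w (2 * c - t)"
      proof -
        \<comment> \<open>Monotonicity and oddness replace linearity: the sum of two signed powers
          has the sign of the sum of their arguments.\<close>
        have "signed_powr a (- w (2 * c - t)) < signed_powr a (w t)"
          by (rule signed_powr_less) (use that dS(1) in auto)
        then show ?thesis using dS(3) by (simp flip: distrib_left)
      qed
      show "0 \<le> l * signed_powr b (u t) + l * signed_powr b (u (2 * c - t))"
        if "0 \<le> u t + u (2 * c - t)"
      proof -
        have "\<not> signed_powr b (u t) < signed_powr b (- u (2 * c - t))"
          using that dS(2) by (simp add: signed_powr_less_iff del: signed_powr_minus)
        then show ?thesis using dS(4) by (simp flip: distrib_left)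
      qed
    qed (use \<open>0 < w c\<close> \<open>u c = 0\<close> in auto)
    then obtain t where "2 * M < u t + u (2 * c - t)" ..
    with B[of t] B[of "2 * c - t"] show False by linarith
  qed
  have "\<not> 0 < w c" by (rule no[OF S B \<open>u c = 0\<close>])
  moreover have "\<not> 0 < - w c"
    by (rule no[OF power_system_uminus[OF S]]) (use B \<open>u c = 0\<close> in auto)
  ultimately show ?thesis by linarith
qed

text \<open>Otherwise u and w would both increase without bound to the right of c.\<close>

lemma power_system_deriv_neg:
  assumes S: "power_system a b k l u u1 w w1" and B: "\<And>t. \<bar>w t\<bar> \<le> M"
    and zero: "u c = 0" "w c = 0" and pos: "\<forall>\<^sub>F t in at_right c. 0 < u t"
  shows "w1 c < 0"
proof (rule ccontr)
  assume "\<not> w1 c < 0"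
  note dS = power_systemD[OF S]
  have S_nonneg: "0 \<le> x \<Longrightarrow> 0 \<le> signed_powr r x" for r x
    by (simp add: signed_powr_nonneg)
  have S_pos: "0 < x \<Longrightarrow> 0 < r \<Longrightarrow> 0 < signed_powr r x" for r x
    using signed_powr_less[of r 0 x] by simp
  obtain e where e: "c < e" and u: "\<And>t. c < t \<Longrightarrow> t < e \<Longrightarrow> 0 < u t"
    using pos by (auto simp: eventually_at_right_field)
  \<comment> \<open>A negative slope at the zero \<open>c\<close> would make \<open>u\<close>
    negative just to its right.\<close>
  have u1c: "0 \<le> u1 c"
  proof (rule ccontr)
    assume "\<not> 0 \<le> u1 c"
    then obtain \<delta> where "0 < \<delta>" and dec: "\<And>h. 0 < h \<Longrightarrow> h < \<delta> \<Longrightarrow> u (c + h) < u c"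
      using DERIV_neg_dec_right[OF dS(5)[of c]] by auto
    define h where "h = min \<delta> (e - c) / 2"
    have "0 < h" "h < \<delta>" "c + h < e" using \<open>0 < \<delta>\<close> e by (auto simp: h_def min_def field_simps)
    with dec[of h] u[of "c + h"] zero show False by simp
  qed
  define m where "m = (c + e) / 2"
  have m: "c < m" "m < e" using e by (auto simp: m_def)
  have w1: "0 \<le> w1 t" if "c \<le> t" "t \<le> m" for t
  proof -
    have "w1 c \<le> w1 t"
    proof (rule deriv_nonneg_imp_le[OF dS(8)])
      show "0 \<le> l * signed_powr b (u s)" if "c < s" "s < t" for s
        using u[of s] that \<open>t \<le> m\<close> m dS(4) by (simp add: S_nonneg)
    qed fact
    with \<open>\<not> w1 c < 0\<close> show ?thesis by linarith
  qed
  have w: "0 \<le> w t" if "c \<le> t" "t \<le> m" for t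
  proof -
    have "w c \<le> w t" by (rule deriv_nonneg_imp_le[OF dS(7)]) (use w1 that in auto)
    with zero show ?thesis by linarith
  qed
  have "u1 c \<le> u1 m"
  proof (rule deriv_nonneg_imp_le[OF dS(6)])
    show "0 \<le> k * signed_powr a (w s)" if "c < s" "s < m" for s
      using w[of s] that dS(3) by (simp add: S_nonneg)
  qed (use m in simp)
  then have "0 \<le> u1 m" using u1c by linarith
  \<comment> \<open>The roles are exchanged: \<open>w\<close> is the growing component and
    \<open>u\<close> the strictly positive one. The start is \<open>m\<close>, not \<open>c\<close>,
    because \<open>u c = 0\<close>.\<close>
  have "\<exists>t. M < w t"
    by (rule cooperative_unbounded[OF dS(7,8,5,6), where c = m])
      (use w w1 u m \<open>0 \<le> u1 m\<close> dS(1-4) in \<open>auto simp: S_nonneg S_pos\<close>)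
  then obtain t where "M < w t" ..
  with B[of t] show False by linarith
qed

text \<open>Up to sign \<open>u > 0\<close> just to the right of \<open>c\<close>, so
  \<open>w1 c < 0\<close>. Then \<open>w\<close> is negative and \<open>u\<close> concave there,
  which with \<open>u1 c = 0\<close> would force \<open>u \<le> 0\<close>.\<close>

lemma power_system_zero_simple:
  assumes S: "power_system a b k l u u1 w w1" and B: "\<And>t. \<bar>w t\<bar> \<le> M"
    and zero: "u c = 0" "w c = 0" and iso: "\<forall>\<^sub>F t in at_right c. u t \<noteq> 0"
  shows "u1 c \<noteq> 0 \<and> w1 c \<noteq> 0"
proof -
  have main: "u1 c \<noteq> 0 \<and> w1 c \<noteq> 0"
    if S: "power_system a b k l u u1 w w1" and B: "\<And>t. \<bar>w t\<bar> \<le> M"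
    and zero: "u c = 0" "w c = 0" and pos: "\<forall>\<^sub>F t in at_right c. 0 < u t" for u u1 w w1
  proof -
    note dS = power_systemD[OF S]
    have w1: "w1 c < 0" using power_system_deriv_neg[OF S B zero pos] .
    have "u1 c \<noteq> 0"
    proof
      assume "u1 c = 0"
      obtain \<delta> where \<delta>: "0 < \<delta>" and dec: "\<And>h. 0 < h \<Longrightarrow> h < \<delta> \<Longrightarrow> w (c + h) < w c"
        using DERIV_neg_dec_right[OF dS(7)[of c]] w1 by auto
      obtain e where e: "c < e" and u: "\<And>t. c < t \<Longrightarrow> t < e \<Longrightarrow> 0 < u t"
        using pos by (auto simp: eventually_at_right_field)
      define h where "h = min \<delta> (e - c) / 2"
      have h: "0 < h" "h < \<delta>" "c + h < e" using \<open>0 < \<delta>\<close> e by (auto simp: h_def min_def field_simps)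
      have w: "w t \<le> 0" if "c < t" "t < c + h" for t
        using dec[of "t - c"] zero h that by simp
      have u1: "u1 t \<le> 0" if "c \<le> t" "t \<le> c + h" for t
      proof -
        have "- u1 c \<le> - u1 t"
        proof (rule deriv_nonneg_imp_le[OF DERIV_minus[OF dS(6)]])
          show "0 \<le> - (k * signed_powr a (w s))" if "c < s" "s < t" for s
          proof -
            have "0 \<le> signed_powr a (- w s)"
              using w[of s] that \<open>t \<le> c + h\<close> by (subst signed_powr_nonneg) auto
            then show ?thesis using dS(3) by (simp add: mult_nonneg_nonpos)
          qed
        qed fact
        with \<open>u1 c = 0\<close> show ?thesis by simp
      qed
      have "- u c \<le> - u (c + h)"
        by (rule deriv_nonneg_imp_le[OF DERIV_minus[OF dS(5)]]) (use u1 h in auto)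
      with u[of "c + h"] h zero show False by simp
    qed
    with w1 show ?thesis by simp
  qed
  obtain e where e: "c < e" and u: "\<And>t. c < t \<Longrightarrow> t < e \<Longrightarrow> u t \<noteq> 0"
    using iso by (auto simp: eventually_at_right_field)
  have "continuous_on {c<..<e} u"
    by (meson power_systemD(5)[OF S] DERIV_isCont continuous_at_imp_continuous_on)
  then have conn: "connected (u ` {c<..<e})"
    by (intro connected_continuous_image) simp_all
  \<comment> \<open>By the intermediate value property, isolation of the zero fixes the sign of
    \<open>u\<close> on its right.\<close>
  have "(\<forall>t\<in>{c<..<e}. 0 < u t) \<or> (\<forall>t\<in>{c<..<e}. u t < 0)"
  proof (rule ccontr)
    assume "\<not> ?thesis"
    then obtain s t where "s \<in> {c<..<e}" "t \<in> {c<..<e}" "u s \<le> 0" "0 \<le> u t" by (force simp: not_less)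
    then have "{u s..u t} \<subseteq> u ` {c<..<e}" "0 \<in> {u s..u t}"
      using connected_contains_Icc[OF conn] by auto
    then show False using u by force
  qed
  then have "(\<forall>\<^sub>F t in at_right c. 0 < u t) \<or> (\<forall>\<^sub>F t in at_right c. 0 < - u t)"
    using e by (auto simp: eventually_at_right_field)
  then show ?thesis
  proof
    assume "\<forall>\<^sub>F t in at_right c. 0 < u t"
    then show ?thesis by (rule main[OF S B zero])
  next
    assume "\<forall>\<^sub>F t in at_right c. 0 < - u t"
    then have "- u1 c \<noteq> 0 \<and> - w1 c \<noteq> 0"
      using B zero by (intro main[OF power_system_uminus[OF S]]) auto
    then show ?thesis by simp
  qed
qed

text \<open>The solution and its odd reflection about \<open>c\<close> have equal data at
  \<open>c\<close>, since \<open>u\<close> and \<open>w\<close> both vanish there. Uniqueness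
  applies because \<open>u\<close> and \<open>w\<close> have the same zeros, all with nonzero
  slopes.\<close>

lemma power_system_odd_about_zero:
  assumes S: "power_system a b k l u u1 w w1" and B: "\<And>t. \<bar>u t\<bar> \<le> M" "\<And>t. \<bar>w t\<bar> \<le> M"
    and iso: "\<And>c. \<forall>\<^sub>F t in at_right c. u t \<noteq> 0" and "u c = 0"
  shows "u (2 * c - t) = - u t"
proof -
  have w: "w t = 0" if "u t = 0" for t
    using power_system_common_zero[OF S B(1) that] .
  have u: "u t = 0" if "w t = 0" for t
    using power_system_common_zero[OF power_system_swap[OF S] B(2) that] .
  have "u t = - u (2 * c - t)"
    by (rule power_system_unique[OF S power_system_uminus[OF power_system_reflect[OF S, of "2 * c"]], where c = c])
      (use \<open>u c = 0\<close> w u power_system_zero_simple[OF S B(2) _ _ iso] in auto)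
  then show ?thesis by simp
qed

section \<open>From odd symmetry to an arithmetic progression\<close>

text \<open>Reflections in zeros carry the zero-free gap between 0 and the first positive zero along
  the half-line, so the nonnegative zeros are the multiples of that first one; counting then
  determines it.\<close>

lemma zeros_equally_spaced:
  fixes u :: "real \<Rightarrow> real"
  assumes odd: "\<And>c t. u c = 0 \<Longrightarrow> u (2 * c - t) = - u t"
    and "u 0 = 0" "u T = 0" "0 < T" and fin: "finite {t \<in> {0<..<T}. u t = 0}"
    and card: "card {t \<in> {0<..<T}. u t = 0} = n - 1" and "1 \<le> n"
  shows "{t \<in> {0<..<T}. u t = 0} = (\<lambda>j. real j * T / real n) ` {1..n - 1}"
proof -
  \<comment> \<open>Including \<open>T\<close> gives \<open>A\<close> a minimum even when there is
    no interior zero.\<close>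
  define A where "A = insert T {t \<in> {0<..<T}. u t = 0}"
  define \<tau> where "\<tau> = Min A"
  have "finite A" "A \<noteq> {}" using fin by (auto simp: A_def)
  then have "\<tau> \<in> A" unfolding \<tau>_def by (rule Min_in)
  then have \<tau>: "0 < \<tau>" "\<tau> \<le> T" "u \<tau> = 0" using assms by (auto simp: A_def)
  have first: "u s \<noteq> 0" if "0 < s" "s < \<tau>" for s
  proof
    assume "u s = 0"
    then have "s \<in> A" using that \<tau> by (auto simp: A_def)
    then have "\<tau> \<le> s" unfolding \<tau>_def using \<open>finite A\<close> by simp
    with that show False by simp
  qed
  have mult: "u (real j * \<tau>) = 0" for j
  proof (induction j rule: induct_nat_012)
    case (ge2 j)
    \<comment> \<open>Reflection in the zero number \<open>j + 1\<close> sends the zero number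
      \<open>j\<close> to number \<open>j + 2\<close>.\<close>
    then show ?case using odd[of "real (Suc j) * \<tau>" "real j * \<tau>"] by (simp add: algebra_simps)
  qed (use assms \<tau> in auto)
  have between: "u (real j * \<tau> + s) \<noteq> 0" if "0 < s" "s < \<tau>" for j s
    using that
  proof (induction j arbitrary: s)
    case 0
    then show ?case using first by simp
  next
    case (Suc j)
    \<comment> \<open>Reflection in \<open>(j + 1) * \<tau>\<close> sends
      \<open>(j + 1) * \<tau> + s\<close> to \<open>j * \<tau> + (\<tau> - s)\<close>, in the
      previous gap.\<close>
    then show ?case using odd[OF mult[of "Suc j"], of "real j * \<tau> + (\<tau> - s)"] Suc.IH[of "\<tau> - s"]
      by (simp add: algebra_simps)
  qed
  have zero: "\<exists>j. t = real j * \<tau>" if "0 \<le> t" "u t = 0" for t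
  proof -
    define j where "j = nat \<lfloor>t / \<tau>\<rfloor>"
    have "real j \<le> t / \<tau>" "t / \<tau> < real j + 1"
      using that \<tau> unfolding j_def by (simp_all add: of_nat_nat)
    then have "0 \<le> t - real j * \<tau>" "t - real j * \<tau> < \<tau>"
      using \<tau> by (auto simp: field_simps)
    moreover have "\<not> (0 < t - real j * \<tau> \<and> t - real j * \<tau> < \<tau>)"
      using between[of "t - real j * \<tau>" j] that by auto
    ultimately show ?thesis by (intro exI[of _ j]) linarith
  qed
  obtain m where m: "T = real m * \<tau>" using zero[of T] assms by auto
  then have "1 \<le> m" using \<open>0 < T\<close> by (cases m) auto
  have eq: "{t \<in> {0<..<T}. u t = 0} = (\<lambda>j. real j * \<tau>) ` {1..m - 1}"
  proof (intro equalityI subsetI)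
    fix t assume t: "t \<in> {t \<in> {0<..<T}. u t = 0}"
    then obtain j where j: "t = real j * \<tau>" using zero[of t] by auto
    with t m \<tau> have "0 < j" "j < m" by (auto simp: zero_less_mult_iff)
    with j show "t \<in> (\<lambda>j. real j * \<tau>) ` {1..m - 1}" by force
  next
    fix t assume "t \<in> (\<lambda>j. real j * \<tau>) ` {1..m - 1}"
    then obtain j where "t = real j * \<tau>" "j \<in> {1..m - 1}" by blast
    moreover from this \<open>1 \<le> m\<close> have "1 \<le> j" "j < m" by auto
    ultimately show "t \<in> {t \<in> {0<..<T}. u t = 0}" using m \<tau> mult[of j] by auto
  qed
  have "inj_on (\<lambda>j. real j * \<tau>) {1..m - 1}" using \<tau> by (auto simp: inj_on_def)
  then have "m - 1 = n - 1" using card unfolding eq by (simp add: card_image)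
  \<comment> \<open>The subtraction is truncated, so both lower bounds enter.\<close>
  then have "m = n" using \<open>1 \<le> m\<close> \<open>1 \<le> n\<close> by linarith
  then have "\<tau> = T / real n" using m \<open>1 \<le> m\<close> by (simp add: field_simps)
  then show ?thesis using eq \<open>m = n\<close> by simp
qed


section \<open>Extension to the line by reflection\<close>

text \<open>The extension of a function on [0, T] by f(-t) = s f(t) and f(2T - t) = s f(t).\<close>

definition refl_ext :: "real \<Rightarrow> real \<Rightarrow> (real \<Rightarrow> real) \<Rightarrow> real \<Rightarrow> real" where
  "refl_ext T s f t = (let k = \<lfloor>t / T\<rfloor> in
    if even k then f (t - of_int k * T) else s * f ((of_int k + 1) * T - t))"

text \<open>The conditions at 0 and \<open>T\<close> make the formulas of adjacent cells agree at
  the common endpoint, so either may be used there. They say that \<open>f\<close> vanishes at the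
  ends if \<open>s = -1\<close>, and nothing if \<open>s = 1\<close>.\<close>

lemma refl_ext_eq:
  assumes "0 < T" and f: "f 0 = s * f 0" "f T = s * f T"
    and t: "of_int k * T \<le> t" "t \<le> (of_int k + 1) * T"
  shows "refl_ext T s f t = (if even k then f (t - of_int k * T) else s * f ((of_int k + 1) * T - t))"
proof (cases "t = (of_int k + 1) * T")
  case True
  then have "\<lfloor>t / T\<rfloor> = k + 1" using \<open>0 < T\<close> by simp
  then show ?thesis using True f by (simp add: refl_ext_def algebra_simps)
next
  case False
  then have "\<lfloor>t / T\<rfloor> = k" using t \<open>0 < T\<close> by (intro floor_unique) (auto simp: field_simps)
  then show ?thesis by (simp add: refl_ext_def)
qed

lemma floor_cell:
  fixes t T :: real
  assumes "0 < T"
  shows "of_int \<lfloor>t / T\<rfloor> * T \<le> t" "t < (of_int \<lfloor>t / T\<rfloor> + 1) * T"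
  using assms of_int_floor_le[of "t / T"] real_of_int_floor_add_one_gt[of "t / T"]
  by (simp_all only: pos_le_divide_eq pos_divide_less_eq)

lemma refl_ext_base:
  assumes "0 < T" "f 0 = s * f 0" "f T = s * f T" "t \<in> {0..T}"
  shows "refl_ext T s f t = f t"
  using refl_ext_eq[of T f s 0 t] assms by simp

text \<open>Differentiating a reflection flips its sign, so an odd extension has an even derivative
  and conversely. The chain rule gives this on each closed cell; at a common endpoint the one-sided
  derivatives agree, both being the value of the extended \<open>f'\<close>.\<close>

lemma refl_ext_deriv:
  assumes "0 < T" and df: "\<And>t. t \<in> {0..T} \<Longrightarrow> (f has_real_derivative f' t) (at t within {0..T})"
    and f: "f 0 = s * f 0" "f T = s * f T" and f': "f' 0 = - s * f' 0" "f' T = - s * f' T"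
  shows "(refl_ext T s f has_real_derivative refl_ext T (- s) f' t) (at t)"
proof -
  have cell: "(refl_ext T s f has_real_derivative refl_ext T (- s) f' t)
      (at t within {of_int k * T..(of_int k + 1) * T})"
    if t: "t \<in> {of_int k * T..(of_int k + 1) * T}" for k t
  proof -
    let ?I = "{of_int k * T..(of_int k + 1) * T}"
    have eq: "refl_ext T s f r = (if even k then f (r - of_int k * T) else s * f ((of_int k + 1) * T - r))"
      if "r \<in> ?I" for r
      using that by (intro refl_ext_eq f \<open>0 < T\<close>) auto
    have eq': "refl_ext T (- s) f' t =
        (if even k then f' (t - of_int k * T) else - s * f' ((of_int k + 1) * T - t))"
      using t by (intro refl_ext_eq f' \<open>0 < T\<close>) auto
    show ?thesis
    proof (cases "even k")
      case True
      have "(f \<circ> (\<lambda>r. r - of_int k * T) has_real_derivative f' (t - of_int k * T) * 1) (at t within ?I)"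
      proof (rule DERIV_image_chain)
        show "(f has_real_derivative f' (t - of_int k * T))
            (at (t - of_int k * T) within (\<lambda>r. r - of_int k * T) ` ?I)"
          by (rule DERIV_subset[OF df]) (use t in \<open>auto simp: algebra_simps\<close>)
      qed (auto intro!: derivative_eq_intros)
      then have "(f \<circ> (\<lambda>r. r - of_int k * T) has_real_derivative refl_ext T (- s) f' t) (at t within ?I)"
        using eq' True by simp
      then show ?thesis
        by (rule has_field_derivative_transform_within[where d = 1]) (use t True eq in auto)
    next
      case False
      have "(f \<circ> (\<lambda>r. (of_int k + 1) * T - r) has_real_derivative
          f' ((of_int k + 1) * T - t) * (- 1)) (at t within ?I)"
      proof (rule DERIV_image_chain)
        show "(f has_real_derivative f' ((of_int k + 1) * T - t))
            (at ((of_int k + 1) * T - t) within (\<lambda>r. (of_int k + 1) * T - r) ` ?I)"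
          by (rule DERIV_subset[OF df]) (use t in \<open>auto simp: algebra_simps\<close>)
      qed (auto intro!: derivative_eq_intros)
      from DERIV_cmult[OF this, of s]
      have "((\<lambda>r. s * f ((of_int k + 1) * T - r)) has_real_derivative refl_ext T (- s) f' t) (at t within ?I)"
        using eq' False by (simp add: o_def)
      then show ?thesis
        by (rule has_field_derivative_transform_within[where d = 1]) (use t False eq in auto)
    qed
  qed
  define k where "k = \<lfloor>t / T\<rfloor>"
  have k: "of_int k * T \<le> t" "t < (of_int k + 1) * T"
    unfolding k_def by (rule floor_cell[OF \<open>0 < T\<close>])+
  show ?thesis
  proof (cases "t = of_int k * T")
    case False
    with k have "at t within {of_int k * T..(of_int k + 1) * T} = at t"
      by (intro at_within_Icc_at) auto
    with cell[of t k] k show ?thesis by simp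
  next
    case True
    have "at t within {of_int k * T..(of_int k + 1) * T} = at_right t"
      using True k by (simp add: at_within_Icc_at_right)
    then have right: "(refl_ext T s f has_real_derivative refl_ext T (- s) f' t) (at_right t)"
      using cell[of t k] k by simp
    \<comment> \<open>At a left endpoint, the left derivative comes from the preceding cell.\<close>
    have "of_int (k - 1) * T < t" "(of_int (k - 1) + 1) * T = t"
      using True \<open>0 < T\<close> by (auto simp: algebra_simps)
    then have "(refl_ext T s f has_real_derivative refl_ext T (- s) f' t) (at_left t)"
      using cell[of t "k - 1"] by (simp add: at_within_Icc_at_left)
    with right show ?thesis
      by (simp add: has_field_derivative_iff filterlim_at_split)
  qed
qed

lemma refl_ext_bounded:
  assumes "0 < T" "\<bar>s\<bar> = 1" and M: "\<And>t. t \<in> {0..T} \<Longrightarrow> \<bar>f t\<bar> \<le> M"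
  shows "\<bar>refl_ext T s f t\<bar> \<le> M"
  using M floor_cell[OF \<open>0 < T\<close>, of t] \<open>\<bar>s\<bar> = 1\<close>
  by (auto simp: refl_ext_def Let_def abs_mult algebra_simps)

lemma refl_ext_zeros_isolated:
  assumes "0 < T" "s \<noteq> 0" and fin: "finite {t \<in> {0<..<T}. f t = 0}"
  shows "\<forall>\<^sub>F t in at_right c. refl_ext T s f t \<noteq> 0"
proof -
  define Z where "Z = {t \<in> {0<..<T}. f t = 0}"
  define k where "k = \<lfloor>c / T\<rfloor>"
  have k: "of_int k * T \<le> c" "c < (of_int k + 1) * T"
    unfolding k_def by (rule floor_cell[OF \<open>0 < T\<close>])+
  \<comment> \<open>Translated and mirrored copies of the zeros are both included, which avoids a
    split on the parity of \<open>k\<close>.\<close>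
  define B where "B = (\<lambda>z. of_int k * T + z) ` Z \<union> (\<lambda>z. (of_int k + 1) * T - z) ` Z"
  have "finite B" using fin unfolding B_def Z_def by simp
  then have "open (- (B - {c}))" by (intro open_Compl finite_imp_closed) simp
  then have "\<forall>\<^sub>F t in at_right c. t \<notin> B"
    unfolding eventually_at_topological by (intro exI[of _ "- (B - {c})"]) auto
  moreover have "\<forall>\<^sub>F t in at_right c. c < t \<and> t < (of_int k + 1) * T"
    using k by (auto simp: eventually_at_right_field)
  ultimately show ?thesis
  proof eventually_elim
    case (elim t)
    then have "\<lfloor>t / T\<rfloor> = k"
      using k \<open>0 < T\<close> by (intro floor_unique) (auto simp: field_simps)
    moreover have "t - of_int k * T \<notin> Z" "(of_int k + 1) * T - t \<notin> Z"
      using elim(1) by (force simp: B_def)+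
    ultimately show ?case
      using elim(2) k \<open>s \<noteq> 0\<close> by (auto simp: refl_ext_def Let_def Z_def algebra_simps)
  qed
qed

section \<open>The boundary value problem\<close>

lemma C1_ivl_deriv:
  assumes "C1_ivl T f" "t \<in> {0..T}"
  shows "(f has_real_derivative ivl_deriv T f t) (at t within {0..T})"
  using assms
  by (simp add: C1_ivl_def differentiable_on_def ivl_deriv_def vector_derivative_works
      has_real_derivative_iff_has_vector_derivative)

theorem corollary5p2:
  fixes p q t0 lam :: real and n :: nat and u :: "real \<Rightarrow> real"
  assumes "1 < p" and "1 < q" and "0 < t0" and "0 < lam" and "1 \<le> n"
    and "is_solution p q lam t0 u"
    and "\<exists>t\<in>{0..t0}. u t \<noteq> 0"
    and "finite {t \<in> {0<..<t0}. u t = 0}"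
    and "card {t \<in> {0<..<t0}. u t = 0} = n - 1"
  shows "(\<forall>z\<in>{0<..<t0}. u z = 0 \<longrightarrow> simple_zero t0 u z) \<and>
    {t \<in> {0<..<t0}. u t = 0} = (\<lambda>j. real j * t0 / real n) ` {1..n - 1} \<and>
    {t \<in> {0<..<t0}. ivl_deriv t0 (ivl_deriv t0 u) t = 0} = (\<lambda>j. real j * t0 / real n) ` {1..n - 1}"
proof -
  define u1 where "u1 = ivl_deriv t0 u"
  define u2 where "u2 = ivl_deriv t0 u1"
  define w where "w = (\<lambda>t. signed_powr (p - 1) (u2 t))"
  define w1 where "w1 = ivl_deriv t0 w"
  \<comment> \<open>The exponent inverse to \<open>p - 1\<close>, so that \<open>u''\<close> is
    recovered from \<open>w\<close>.\<close>
  define a where "a = 1 / (p - 1)"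
  define b where "b = q - 1"
  have sol: "C1_ivl t0 u" "C1_ivl t0 u1" "C1_ivl t0 w" "C1_ivl t0 w1"
      "\<And>t. t \<in> {0..t0} \<Longrightarrow> ivl_deriv t0 w1 t = lam * signed_powr b (u t)"
      "u 0 = 0" "u t0 = 0" "w 0 = 0" "w t0 = 0"
    using \<open>is_solution p q lam t0 u\<close>
    unfolding is_solution_def Let_def u1_def u2_def w_def w1_def b_def by auto
  have u2: "u2 t = signed_powr a (w t)" for t
    using \<open>1 < p\<close> by (simp add: a_def w_def signed_powr_inverse)
  have du: "(u has_real_derivative u1 t) (at t within {0..t0})"
    and du1: "(u1 has_real_derivative signed_powr a (w t)) (at t within {0..t0})"
    and dw: "(w has_real_derivative w1 t) (at t within {0..t0})"
    and dw1: "(w1 has_real_derivative lam * signed_powr b (u t)) (at t within {0..t0})"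
    if "t \<in> {0..t0}" for t
    using C1_ivl_deriv[OF sol(1) that] C1_ivl_deriv[OF sol(2) that] C1_ivl_deriv[OF sol(3) that]
      C1_ivl_deriv[OF sol(4) that] sol(5)[OF that]
    by (simp_all flip: u1_def u2_def w1_def add: u2)
  define U where "U = refl_ext t0 (- 1) u"
  define W where "W = refl_ext t0 (- 1) w"
  have odd: "refl_ext t0 (- 1) (\<lambda>t. m * signed_powr r (f t)) t = m * signed_powr r (refl_ext t0 (- 1) f t)"
    for m r f t
    by (simp add: refl_ext_def Let_def)
  \<comment> \<open>The boundary conditions enter twice: they make the odd extensions of
    \<open>u\<close> and \<open>w\<close> continuous, and they make the second derivatives vanish at
    the ends, so that the even extensions of \<open>u1\<close> and \<open>w1\<close> are
    differentiable there.\<close>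
  have S: "power_system a b 1 lam U (refl_ext t0 1 u1) W (refl_ext t0 1 w1)"
    unfolding power_system_def
  proof (intro conjI allI)
    fix t
    show "(U has_real_derivative refl_ext t0 1 u1 t) (at t)"
      using refl_ext_deriv[OF \<open>0 < t0\<close> du, of "- 1" t] sol by (simp add: U_def)
    show "(W has_real_derivative refl_ext t0 1 w1 t) (at t)"
      using refl_ext_deriv[OF \<open>0 < t0\<close> dw, of "- 1" t] sol by (simp add: W_def)
    show "(refl_ext t0 1 u1 has_real_derivative 1 * signed_powr a (W t)) (at t)"
      using refl_ext_deriv[OF \<open>0 < t0\<close> du1, of 1 t] sol odd[of 1 a w t] by (simp add: W_def)
    show "(refl_ext t0 1 w1 has_real_derivative lam * signed_powr b (U t)) (at t)"
      using refl_ext_deriv[OF \<open>0 < t0\<close> dw1, of 1 t] sol odd[of lam b u t] by (simp add: U_def)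
  qed (use assms(1-4) in \<open>auto simp: a_def b_def\<close>)
  have "bounded (f ` {0..t0})"
    if "\<And>t. t \<in> {0..t0} \<Longrightarrow> (f has_real_derivative f' t) (at t within {0..t0})" for f f'
    using that by (intro compact_imp_bounded compact_continuous_image DERIV_continuous_on) auto
  from this[OF du] this[OF dw]
  obtain M1 M2 where M: "\<And>t. t \<in> {0..t0} \<Longrightarrow> \<bar>u t\<bar> \<le> M1" "\<And>t. t \<in> {0..t0} \<Longrightarrow> \<bar>w t\<bar> \<le> M2"
    unfolding bounded_iff by (auto simp del: atLeastAtMost_iff)
  have BU: "\<bar>U t\<bar> \<le> max M1 M2" and BW: "\<bar>W t\<bar> \<le> max M1 M2" for t
    unfolding U_def W_def
    by (rule refl_ext_bounded[OF \<open>0 < t0\<close>]; use M in \<open>force simp: le_max_iff_disj\<close>)+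
  have iso: "\<forall>\<^sub>F t in at_right c. U t \<noteq> 0" for c
    unfolding U_def by (rule refl_ext_zeros_isolated) (use assms in auto)
  have U: "U t = u t" and W: "W t = w t" if "t \<in> {0..t0}" for t
    unfolding U_def W_def using sol \<open>0 < t0\<close> that by (simp_all add: refl_ext_base)
  \<comment> \<open>Both inclusions come from \<open>power_system_common_zero\<close>, once with
    \<open>u\<close> and \<open>w\<close> exchanged.\<close>
  have WU: "W t = 0 \<longleftrightarrow> U t = 0" for t
    using power_system_common_zero[OF S BU] power_system_common_zero[OF power_system_swap[OF S] BW]
    by blast
  have ZU: "{t \<in> {0<..<t0}. U t = 0} = {t \<in> {0<..<t0}. u t = 0}" using U by auto
  have "{t \<in> {0<..<t0}. U t = 0} = (\<lambda>j. real j * t0 / real n) ` {1..n - 1}"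
  proof (rule zeros_equally_spaced)
    show "U (2 * c - t) = - U t" if "U c = 0" for c t
      by (rule power_system_odd_about_zero[OF S BU BW iso that])
  qed (use assms sol U[of 0] U[of t0] ZU in auto)
  then have zeros: "{t \<in> {0<..<t0}. u t = 0} = (\<lambda>j. real j * t0 / real n) ` {1..n - 1}"
    using ZU by simp
  have "ivl_deriv t0 (ivl_deriv t0 u) t = 0 \<longleftrightarrow> u t = 0" if "t \<in> {0<..<t0}" for t
  proof -
    have "u2 t = 0 \<longleftrightarrow> w t = 0" by (simp add: u2 signed_powr_eq_0_iff)
    also have "\<dots> \<longleftrightarrow> u t = 0" using that U[of t] W[of t] WU[of t] by simp
    finally show ?thesis by (simp add: u2_def u1_def)
  qed
  then have zeros2: "{t \<in> {0<..<t0}. ivl_deriv t0 (ivl_deriv t0 u) t = 0} = {t \<in> {0<..<t0}. u t = 0}"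
    by auto
  have "simple_zero t0 u z" if z: "z \<in> {0<..<t0}" "u z = 0" for z
  proof -
    have "U z = 0" "W z = 0" using z U[of z] WU[of z] by auto
    then have "refl_ext t0 1 u1 z \<noteq> 0" using power_system_zero_simple[OF S BW _ _ iso] by blast
    moreover have "refl_ext t0 1 u1 z = u1 z" using z \<open>0 < t0\<close> by (intro refl_ext_base) auto
    ultimately show ?thesis using z by (simp add: simple_zero_def u1_def)
  qed
  with zeros zeros2 show ?thesis by simp
qed

end
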